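(* For every $d\in\mathbb N$ and $0<\delta<1$, \[ B_{[]}^{\rm sh}(d,\delta)\le d+\left(1+\frac{\sqrt{d\delta}}{\log(1+\delta)}+(1+\sqrt{d\delta})\log\frac{d}{\delta\log(1+\delta)}\right)\delta^{-d}\left(1+3\delta+3\sqrt{\frac\delta d}\right)^d . \]
   Context: For given $d\in\mathbb N$, $0<\delta<1$, define recursively $L_0=0$, $c_i:=\log(1+\delta e^{L_i})$, $L_{i+1}:=\min\{L_i+c_i/\sqrt{d\delta},\ d\log(\delta^{-1})\}$, and let $J$ be the first index with $L_J=d\log(\delta^{-1})$ (it exists). For $0\le i<J$ put \[ r_i^-:=\max\Bigl\{0,\Bigl\lceil d\Bigl(\frac{L_i}{c_i}-1\Bigr)\Bigr\rceil\Bigr\},\qquad r_i^+:=\Bigl\lceil\frac{dL_{i+1}}{c_i}\Bigr\rceil-1, \] $\mathcal A_i:=\{\boldsymbol n\in\mathbb N_0^d: r_i^-\le\sum_{j=1}^dn_j\le r_i^+\}$, and \[ B_{[]}^{\rm sh}(d,\delta):=d+\sum_{i=0}^{J-1}|\mathcal A_i| . \] *)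

theory Defs
  imports Complex_Main
begin

text \<open>
  All notions depend on a dimension \<open>d\<close> and a number \<open>\<delta>\<close>;
  they are meaningful for \<open>d \<ge> 1\<close> and \<open>0 < \<delta> < 1\<close>.
\<close>

primrec level :: "nat \<Rightarrow> real \<Rightarrow> nat \<Rightarrow> real" where
  "level d \<delta> 0 = 0"
| "level d \<delta> (Suc i) =
     min (level d \<delta> i + ln (1 + \<delta> * exp (level d \<delta> i)) / sqrt (real d * \<delta>))
         (real d * ln (inverse \<delta>))"

definition level_width :: "nat \<Rightarrow> real \<Rightarrow> nat \<Rightarrow> real" where
  "level_width d \<delta> i = ln (1 + \<delta> * exp (level d \<delta> i))"

definition num_levels :: "nat \<Rightarrow> real \<Rightarrow> nat" where
  "num_levels d \<delta> = (LEAST j. level d \<delta> j = real d * ln (inverse \<delta>))"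

definition r_minus :: "nat \<Rightarrow> real \<Rightarrow> nat \<Rightarrow> int" where
  "r_minus d \<delta> i = max 0 \<lceil>real d * (level d \<delta> i / level_width d \<delta> i - 1)\<rceil>"

definition r_plus :: "nat \<Rightarrow> real \<Rightarrow> nat \<Rightarrow> int" where
  "r_plus d \<delta> i = \<lceil>real d * level d \<delta> (Suc i) / level_width d \<delta> i\<rceil> - 1"

text \<open>Multi-indices in \<open>\<nat>\<^sub>0\<^sup>d\<close> are lists of natural numbers of length \<open>d\<close>.\<close>

definition shell_indices :: "nat \<Rightarrow> real \<Rightarrow> nat \<Rightarrow> nat list set" where
  "shell_indices d \<delta> i =
     {n. length n = d \<and> r_minus d \<delta> i \<le> int (sum_list n) \<and> int (sum_list n) \<le> r_plus d \<delta> i}"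

definition B_shell :: "nat \<Rightarrow> real \<Rightarrow> nat" where
  "B_shell d \<delta> = d + (\<Sum>i<num_levels d \<delta>. card (shell_indices d \<delta> i))"

text \<open>The least index in \<^const>\<open>num_levels\<close> and the cardinalities in \<^const>\<open>B_shell\<close>
  are genuine: the level is reached, and each index set is finite.\<close>

lemma level_reaches_top:
  assumes "d \<ge> 1" "0 < \<delta>" "\<delta> < 1"
  shows "\<exists>j. level d \<delta> j = real d * ln (inverse \<delta>)"
proof (rule ccontr)
  assume neq: "\<not> ?thesis"
  define s where "s = sqrt (real d * \<delta>)"
  define T where "T = real d * ln (inverse \<delta>)"
  define c where "c = ln (1 + \<delta>) / s"
  have s: "s > 0" and c: "c > 0"
    using assms by (auto simp: s_def c_def)
  have T: "T \<ge> 0"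
    using assms by (simp add: T_def ln_inverse mult_nonneg_nonpos)
  have le_T: "level d \<delta> i \<le> T" for i
    using T by (cases i) (auto simp: T_def)
  have "real i * c \<le> level d \<delta> i" for i
  proof (induction i)
    case 0
    show ?case by simp
  next
    case (Suc i)
    let ?L = "level d \<delta> i"
    have "level d \<delta> (Suc i) \<noteq> T"
      using neq unfolding T_def by blast
    hence eq: "level d \<delta> (Suc i) = ?L + ln (1 + \<delta> * exp ?L) / s"
      unfolding level.simps s_def T_def by linarith
    have "0 \<le> ?L"
      using Suc c by (meson mult_nonneg_nonneg of_nat_0_le_iff less_imp_le order_trans)
    hence "ln (1 + \<delta>) \<le> ln (1 + \<delta> * exp ?L)"
      using assms by (intro ln_mono) (auto simp: add_pos_pos)
    hence "c \<le> ln (1 + \<delta> * exp ?L) / s"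
      using s by (simp add: c_def divide_right_mono)
    thus ?case
      unfolding eq using Suc by (simp add: algebra_simps)
  qed
  moreover obtain n where "T < real n * c"
    using reals_Archimedean3[OF c] by blast
  ultimately show False
    using le_T[of n] by (meson not_le order_trans)
qed

lemma finite_shell_indices: "finite (shell_indices d \<delta> i)"
proof (rule finite_subset)
  show "shell_indices d \<delta> i \<subseteq> {n. set n \<subseteq> {..nat (r_plus d \<delta> i)} \<and> length n = d}"
    using member_le_sum_list by (fastforce simp: shell_indices_def)
  show "finite {n. set n \<subseteq> {..nat (r_plus d \<delta> i)} \<and> length n = d}"
    by (rule finite_lists_length_eq) simp
qed

end

theory Submission
  imports Defs "HOL-Real_Asymp.Real_Asymp"
begin

text \<open>
  The sum over the shells is at most the number of shells times the largest shell, and the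
  two factors on the right-hand side bound these two quantities. Write \<open>s = sqrt (d \<delta>)\<close>,
  \<open>L\<close> for a level and \<open>c = ln (1 + \<delta> exp L)\<close> for its width.

  \<^emph>\<open>Size of a shell.\<close> A shell lies in the simplex of all multi-indices of sum at most
  \<open>d z\<close>, where \<open>z = L / c + 1 / s\<close>. A single term of the binomial expansion of \<open>1\<close> shows that
  this simplex has at most \<open>F(z)\<^sup>d\<close> points, where \<open>F(z) = (1 + z)\<^bsup>1 + z\<^esup> / z\<^bsup>z\<^esup>\<close>
  (\<open>binomial_le_entropy_exp\<close>). So \<open>F(z) \<le> 1 / \<delta> + 3 + 3 / s\<close> is what has to be shown. The
  definition of \<open>c\<close> says \<open>1 / \<delta> = exp L / (exp c - 1)\<close>, and for a fixed ratio \<open>x = L / c > 1\<close> the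
  minimum of \<open>exp (c x) / (exp c - 1)\<close> over \<open>c\<close> is exactly \<open>F(x - 1)\<close>
  (\<open>entropy_exp_le_geometric\<close>). Hence it suffices that \<open>F\<close> grows by at most \<open>3 (1 + 1 / s)\<close>
  from \<open>x - 1\<close> to \<open>x + 1 / s\<close>. This holds because \<open>F\<close> is concave and \<open>F(1) - F(0) = 4 - 1 = 3\<close>
  (\<open>entropy_exp_le_plus_3\<close>), which is also where the constant \<open>3\<close> of the bound comes from.

  \<^emph>\<open>Number of shells.\<close> As a function of the level, the width has derivative \<open>1 - exp (- c)\<close>,
  and each level step has length \<open>c / s\<close>. In the continuous picture the number of steps is thus
  the integral of \<open>s / (c (1 - exp (- c)))\<close> over \<open>c\<close>, and \<open>1 / (1 - exp (- c)) \<le> 1 + 1 / c\<close> leads to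
  the antiderivative \<open>s ln c - s / c\<close>. The additional \<open>ln c\<close> in
  \<open>\<Phi>(c) = (1 + s) ln c - s / c\<close> pays for the discretization: \<open>\<Phi>\<close> grows by at least \<open>1\<close>
  in every full step (\<open>potential_step\<close>). Since the widths run from \<open>ln (1 + \<delta>)\<close> to at most
  \<open>d / \<delta>\<close>, the increase of \<open>\<Phi>\<close> gives the first factor (\<open>num_levels_le\<close>).
\<close>

section \<open>Concavity and growth of the entropy function\<close>

text \<open>
  This is \<open>(1 + z)\<^bsup>1 + z\<^esup> / z\<^bsup>z\<^esup>\<close>, the exponential of the entropy of the geometric
  distribution with mean \<open>z\<close>. With the convention \<^term>\<open>ln 0 = (0 :: real)\<close> it takes its
  limit value \<open>1\<close> at \<open>z = 0\<close>.
\<close>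

definition entropy_exp :: "real \<Rightarrow> real" where
  "entropy_exp z = exp ((1 + z) * ln (1 + z) - z * ln z)"

text \<open>
  Gibbs' inequality: with \<open>t = exp (- c)\<close> the right-hand side is \<open>t\<^bsup>- a\<^esup> / (1 - t)\<close>, whose
  logarithm is the cross entropy of the geometric distribution with mean \<open>a\<close> relative to the one
  with parameter \<open>t\<close>. It is smallest when the two distributions agree, i.e. for
  \<open>t = a / (1 + a)\<close>.
\<close>

lemma entropy_exp_le_geometric:
  fixes a c :: real
  assumes "a > 0" "c > 0"
  shows "entropy_exp a \<le> exp (c * (1 + a)) / (exp c - 1)"
proof -
  define t where "t = exp (- c)"
  have t: "0 < t" "t < 1" and ln_t: "ln t = - c"
    using assms by (auto simp: t_def)
  have "a * ln (t * (1 + a) / a) \<le> a * (t * (1 + a) / a - 1)"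
    using assms t by (intro mult_left_mono ln_le_minus_one) auto
  also have "\<dots> = t * (1 + a) - a"
    using assms by (simp add: field_simps)
  finally have 1: "a * ln (t * (1 + a) / a) \<le> t * (1 + a) - a" .
  have 2: "ln ((1 - t) * (1 + a)) \<le> (1 - t) * (1 + a) - 1"
    using assms t by (intro ln_le_minus_one) auto
  have e1: "ln (t * (1 + a) / a) = - c + ln (1 + a) - ln a"
    using assms t ln_t by (simp add: ln_mult ln_div)
  have e2: "ln ((1 - t) * (1 + a)) = ln (1 - t) + ln (1 + a)"
    using assms t by (simp add: ln_mult)
  have e3: "a * (- c + ln (1 + a) - ln a) + (ln (1 - t) + ln (1 + a)) \<le> 0"
    using 1 2 unfolding e1 e2 by (simp add: algebra_simps)
  have "(1 + a) * ln (1 + a) - a * ln a \<le> c * a - ln (1 - t)"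
    using e3 by (simp add: algebra_simps)
  hence "entropy_exp a \<le> exp (c * a - ln (1 - t))"
    by (simp add: entropy_exp_def)
  also have "\<dots> = exp (c * (1 + a)) / (exp c - 1)"
    using t assms by (simp add: exp_diff t_def exp_minus field_simps exp_add)
  finally show ?thesis .
qed

lemma DERIV_entropy_exp:
  assumes "z > 0"
  shows "(entropy_exp has_real_derivative entropy_exp z * ln (1 + 1 / z)) (at z)"
proof -
  have "1 + 1 / z = (1 + z) / z" using assms by (simp add: field_simps)
  hence ln_eq: "ln (1 + 1 / z) = ln (1 + z) - ln z"
    using assms by (simp add: ln_div)
  have "((\<lambda>z. (1 + z) * ln (1 + z) - z * ln z) has_real_derivative ln (1 + 1 / z)) (at z)"
    unfolding ln_eq using assms by (auto intro!: derivative_eq_intros)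
  thus ?thesis
    unfolding entropy_exp_def [abs_def] by (rule DERIV_fun_exp)
qed

text \<open>
  For \<open>u = ln (1 + 1 / z) / 2\<close> this is the square of \<open>u \<le> sinh u\<close>. It says that the second
  derivative of \<^const>\<open>entropy_exp\<close> is nonpositive.
\<close>

lemma ln_squared_le:
  fixes z :: real
  assumes "z > 0"
  shows "(ln (1 + 1 / z))\<^sup>2 \<le> 1 / (z * (1 + z))"
proof -
  define u where "u = ln (1 + 1 / z) / 2"
  have u: "u \<ge> 0" using assms by (simp add: u_def)
  have sq: "(exp u)\<^sup>2 = 1 + 1 / z"
    using assms by (simp add: u_def add_pos_pos flip: exp_double)
  have "2 * u \<le> exp u - inverse (exp u)"
    using real_le_x_sinh [of u] u by simp
  hence "(2 * u)\<^sup>2 \<le> (exp u - inverse (exp u))\<^sup>2"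
    using u by (intro power_mono) auto
  also have "\<dots> = (exp u)\<^sup>2 - 2 + inverse ((exp u)\<^sup>2)"
    by (simp add: power2_diff power_inverse)
  also have "\<dots> = 1 / (z * (1 + z))"
    unfolding sq using assms by (simp add: field_simps)
  finally show ?thesis by (simp add: u_def)
qed

lemma slope_entropy_exp_antimono:
  assumes "0 < x" "x \<le> y"
  shows "entropy_exp y * ln (1 + 1 / y) \<le> entropy_exp x * ln (1 + 1 / x)"
proof (rule DERIV_nonpos_imp_nonincreasing [OF assms(2)])
  fix z assume "x \<le> z"
  hence z: "z > 0" using assms by simp
  have "((\<lambda>z. 1 + 1 / z) has_real_derivative - (1 / z\<^sup>2)) (at z)"
    using z by (auto intro!: derivative_eq_intros simp: power2_eq_square)
  hence "((\<lambda>z. ln (1 + 1 / z)) has_real_derivative 1 / (1 + 1 / z) * - (1 / z\<^sup>2)) (at z)"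
    using z by (intro DERIV_chain2 [OF DERIV_ln_divide]) (auto simp: add_pos_pos)
  also have "1 / (1 + 1 / z) * - (1 / z\<^sup>2) = - (1 / (z * (1 + z)))"
    using z by (simp add: field_simps power2_eq_square)
  finally have "((\<lambda>z. ln (1 + 1 / z)) has_real_derivative - (1 / (z * (1 + z)))) (at z)" .
  from DERIV_mult [OF DERIV_entropy_exp [OF z] this]
  have "((\<lambda>z. entropy_exp z * ln (1 + 1 / z)) has_real_derivative
      entropy_exp z * ((ln (1 + 1 / z))\<^sup>2 - 1 / (z * (1 + z)))) (at z)"
    by (simp add: algebra_simps power2_eq_square)
  moreover have "entropy_exp z * ((ln (1 + 1 / z))\<^sup>2 - 1 / (z * (1 + z))) \<le> 0"
    using ln_squared_le [OF z] by (intro mult_nonneg_nonpos) (auto simp: entropy_exp_def)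
  ultimately show "\<exists>D. ((\<lambda>z. entropy_exp z * ln (1 + 1 / z)) has_real_derivative D) (at z) \<and> D \<le> 0"
    by blast
qed

text \<open>
  Continuity at \<open>0\<close>, where the derivative is infinite, is needed to apply Rolle's theorem on
  the interval from \<open>0\<close> to \<open>1\<close>.
\<close>

lemma continuous_on_entropy_exp: "continuous_on {0..} entropy_exp"
proof (rule continuous_on_eq_continuous_within [THEN iffD2], rule ballI)
  fix z :: real assume z: "z \<in> {0..}"
  show "continuous (at z within {0..}) entropy_exp"
  proof (cases "z = 0")
    case True
    have "((\<lambda>z::real. exp ((1 + z) * ln (1 + z) - z * ln z)) \<longlongrightarrow> 1) (at_right 0)"
      by real_asymp
    thus ?thesis
      unfolding continuous_within True at_within_Ici_at_right
      by (simp add: entropy_exp_def [abs_def])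
  next
    case False
    hence "z > 0" using z by simp
    thus ?thesis
      by (meson DERIV_entropy_exp DERIV_isCont continuous_at_imp_continuous_at_within)
  qed
qed

text \<open>
  The function \<open>g(z) = entropy_exp z - 3 z\<close> is concave and takes the same value at \<open>0\<close> and \<open>1\<close>.
  So it increases up to some \<open>\<xi>\<close> in between and decreases afterwards. If \<open>a \<ge> \<xi>\<close>, this already
  gives \<open>g(b) \<le> g(a)\<close>; otherwise \<open>g(b) \<le> g(1) = g(0) \<le> g(a)\<close>, as \<open>b \<ge> 1\<close>.
\<close>

lemma entropy_exp_le_plus_3:
  assumes "0 \<le> a" "a + 1 \<le> b"
  shows "entropy_exp b \<le> entropy_exp a + 3 * (b - a)"
proof -
  define g where "g = (\<lambda>z. entropy_exp z - 3 * z)"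
  let ?g' = "\<lambda>z. entropy_exp z * ln (1 + 1 / z) - 3"
  have deriv: "(g has_real_derivative ?g' z) (at z)" if "z > 0" for z
    unfolding g_def using that by (auto intro!: derivative_eq_intros DERIV_entropy_exp)
  have cont: "continuous_on S g" if "S \<subseteq> {0..}" for S
    unfolding g_def
    by (intro continuous_intros continuous_on_subset [OF continuous_on_entropy_exp that])
  have "exp (2 * ln 2) = (2::real)\<^sup>2"
    by (simp only: exp_double) simp
  hence g01: "g 0 = 1" "g 1 = 1"
    by (simp_all add: g_def entropy_exp_def)
  have "\<exists>z. 0 < z \<and> z < 1 \<and> (g has_real_derivative 0) (at z)"
    using g01 cont [of "{0..1}"] deriv
    by (intro Rolle) (auto simp: real_differentiable_def)
  then obtain \<xi> where \<xi>: "0 < \<xi>" "\<xi> < 1" "?g' \<xi> = 0"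
    using DERIV_unique deriv by blast
  have dec: "g y \<le> g x" if "\<xi> \<le> x" "x \<le> y" for x y
  proof (rule DERIV_nonpos_imp_nonincreasing [OF that(2)])
    fix z assume "x \<le> z"
    hence "z > 0" "?g' z \<le> 0"
      using that \<xi> slope_entropy_exp_antimono [of \<xi> z] by auto
    thus "\<exists>D. (g has_real_derivative D) (at z) \<and> D \<le> 0" using deriv by blast
  qed
  have inc: "g 0 \<le> g x" if "0 \<le> x" "x \<le> \<xi>" for x
  proof (rule DERIV_nonneg_imp_increasing_open [OF that(1)])
    fix z assume "0 < z" "z < x"
    hence "z > 0" "?g' z \<ge> 0"
      using that \<xi> slope_entropy_exp_antimono [of z \<xi>] by auto
    thus "\<exists>D. (g has_real_derivative D) (at z) \<and> D \<ge> 0" using deriv by blast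
  qed (rule cont, auto)
  have "g b \<le> g a"
  proof (cases "\<xi> \<le> a")
    case True
    thus ?thesis using dec assms by simp
  next
    case False
    have "g b \<le> g 1" using dec [of 1 b] \<xi> assms by simp
    also have "\<dots> = g 0" using g01 by simp
    also have "\<dots> \<le> g a" using inc [of a] False assms by simp
    finally show ?thesis .
  qed
  thus ?thesis by (simp add: g_def algebra_simps)
qed

lemma entropy_exp_mono:
  assumes "0 < x" "x \<le> y"
  shows "entropy_exp x \<le> entropy_exp y"
proof (rule DERIV_nonneg_imp_nondecreasing [OF assms(2)])
  fix z assume "x \<le> z"
  hence "z > 0" using assms by simp
  thus "\<exists>D. (entropy_exp has_real_derivative D) (at z) \<and> D \<ge> 0"
    by (intro exI conjI, rule DERIV_entropy_exp) (auto simp: entropy_exp_def)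
qed

section \<open>Counting the multi-indices of a shell\<close>

text \<open>
  Prepending the slack entry \<open>r - sum_list n\<close> turns a list of sum at most \<open>r\<close> into a list of
  length \<open>d + 1\<close> and sum exactly \<open>r\<close>.
\<close>

lemma card_sum_list_le:
  "card {n :: nat list. length n = d \<and> sum_list n \<le> r} \<le> (r + d) choose d"
proof -
  let ?S = "{n :: nat list. length n = d \<and> sum_list n \<le> r}"
  let ?T = "{n :: nat list. length n = Suc d \<and> sum_list n = r}"
  have card_T: "card ?T = (r + d) choose r"
    using card_length_sum_list [of "Suc d" r] by simp
  have "?T \<subseteq> {n. set n \<subseteq> {..r} \<and> length n = Suc d}"
    using member_le_sum_list by fastforce
  hence "finite ?T"
    by (rule finite_subset) (rule finite_lists_length_eq, simp)
  moreover have "inj_on (\<lambda>n. (r - sum_list n) # n) ?S"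
    by (rule inj_onI) simp
  moreover have "(\<lambda>n. (r - sum_list n) # n) ` ?S \<subseteq> ?T"
    by auto
  ultimately have "card ?S \<le> card ?T"
    using card_inj_on_le by blast
  also have "\<dots> = (r + d) choose d"
    unfolding card_T using binomial_symmetric [of r "r + d"] by simp
  finally show ?thesis .
qed

text \<open>
  One summand in the binomial expansion of \<open>(p + (1 - p))\<^bsup>r + d\<^esup> = 1\<close> is at most \<open>1\<close>; the
  best choice for \<open>r = d z\<close> is the success probability \<open>p = 1 / (1 + z)\<close>.
\<close>

lemma binomial_le_entropy_exp:
  assumes "z > 0" "real r \<le> real d * z"
  shows "real ((r + d) choose d) \<le> entropy_exp z ^ d"
proof -
  define p where "p = 1 / (1 + z)"
  have p: "p > 0" "1 - p > 0" "p + (1 - p) = 1"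
    using assms by (auto simp: p_def)
  have "real ((r + d) choose d) * p ^ d * (1 - p) ^ (r + d - d)
      \<le> (\<Sum>k\<le>r + d. real ((r + d) choose k) * p ^ k * (1 - p) ^ (r + d - k))"
    using p by (intro member_le_sum) auto
  also have "\<dots> = (p + (1 - p)) ^ (r + d)"
    by (simp only: binomial_ring)
  also have "\<dots> = 1" by simp
  finally have "real ((r + d) choose d) \<le> 1 / (p ^ d * (1 - p) ^ r)"
    using p by (simp add: field_simps)
  also have "\<dots> = (1 + z) ^ d * ((1 + z) / z) ^ r"
    using assms by (simp add: p_def field_simps)
  also have "((1 + z) / z) ^ r = ((1 + z) / z) powr real r"
    using assms by (simp add: powr_realpow)
  also have "\<dots> \<le> ((1 + z) / z) powr (real d * z)"
    using assms by (intro powr_mono) auto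
  also have "\<dots> = exp (z * (ln (1 + z) - ln z)) ^ d"
    using assms by (simp add: powr_def ln_div mult_ac flip: exp_of_nat_mult)
  also have "(1 + z) ^ d * \<dots> = (exp (ln (1 + z)) * exp (z * (ln (1 + z) - ln z))) ^ d"
    using assms by (simp add: power_mult_distrib)
  also have "\<dots> = entropy_exp z ^ d"
    by (simp add: entropy_exp_def algebra_simps flip: exp_add)
  finally show ?thesis using assms by (simp add: mult_left_mono)
qed

text \<open>
  Below ratio \<open>x = L / c = 1\<close> monotonicity and \<open>1 / \<delta> \<ge> 1\<close> suffice. Above it, \<open>1 / \<delta>\<close> is
  bounded from below in terms of \<open>x\<close> alone, by the value at \<open>x - 1\<close>, and the
  growth estimate is applied from \<open>x - 1\<close> to \<open>x + h\<close>.
\<close>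

lemma entropy_exp_shell_le:
  fixes L \<delta> h :: real
  assumes "0 \<le> L" "0 < \<delta>" "\<delta> < 1" "0 < h"
  defines "c \<equiv> ln (1 + \<delta> * exp L)"
  shows "entropy_exp (L / c + h) \<le> 1 / \<delta> + 3 + 3 * h"
proof -
  have c: "c > 0" using assms unfolding c_def by (intro ln_gt_zero) simp
  have "exp c = 1 + \<delta> * exp L"
    using assms by (simp add: c_def add_pos_pos)
  define x where "x = L / c"
  have x: "x \<ge> 0" "c * x = L" using c assms by (auto simp: x_def)
  show ?thesis
  proof (cases "x > 1")
    case True
    have "entropy_exp (x + h) \<le> entropy_exp (x - 1) + 3 * (1 + h)"
      using entropy_exp_le_plus_3 [of "x - 1" "x + h"] True assms by (simp add: algebra_simps)
    also have "entropy_exp (x - 1) \<le> exp (c * (1 + (x - 1))) / (exp c - 1)"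
      using True c by (intro entropy_exp_le_geometric) auto
    also have "\<dots> = 1 / \<delta>"
      using x \<open>exp c = _\<close> assms by simp
    finally show ?thesis by (simp add: x_def)
  next
    case False
    have "entropy_exp (x + h) \<le> entropy_exp (1 + h)"
      using False x assms by (intro entropy_exp_mono) auto
    also have "\<dots> \<le> entropy_exp 0 + 3 * (1 + h)"
      using entropy_exp_le_plus_3 [of 0 "1 + h"] assms by simp
    also have "\<dots> \<le> 1 / \<delta> + 3 + 3 * h"
      using assms by (simp add: entropy_exp_def)
    finally show ?thesis by (simp add: x_def)
  qed
qed

lemma level_nonneg:
  assumes "0 < \<delta>" "\<delta> < 1"
  shows "0 \<le> level d \<delta> i"
proof (induction i)
  case (Suc i)
  thus ?case using assms by (auto simp: ln_inverse mult_nonneg_nonpos)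
qed simp

lemma level_width_pos:
  assumes "0 < \<delta>"
  shows "level_width d \<delta> i > 0"
  using assms by (simp add: level_width_def ln_gt_zero)

text \<open>
  The shell is enlarged to the simplex of all multi-indices with sum at most
  \<^term>\<open>r_plus d \<delta> i\<close>. A level step has length at most \<open>c / s\<close>, so this sum is at most
  \<open>d (L / c + 1 / s)\<close>.
\<close>

lemma card_shell_indices_le:
  assumes "d \<ge> 1" "0 < \<delta>" "\<delta> < 1"
  shows "real (card (shell_indices d \<delta> i)) \<le>
    \<delta> powi (- int d) * (1 + 3 * \<delta> + 3 * sqrt (\<delta> / real d)) ^ d"
proof -
  define s where "s = sqrt (real d * \<delta>)"
  define L where "L = level d \<delta> i"
  define c where "c = level_width d \<delta> i"
  define z where "z = L / c + 1 / s"
  have s: "s > 0" using assms by (simp add: s_def)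
  have L: "L \<ge> 0" unfolding L_def by (rule level_nonneg [OF assms(2,3)])
  have c: "c > 0" unfolding c_def by (rule level_width_pos [OF assms(2)])
  have z: "z > 0" using s L c by (simp add: z_def add_nonneg_pos)
  have "\<delta> / s = sqrt (\<delta> / real d)"
    using assms by (simp add: s_def real_sqrt_mult real_sqrt_divide real_div_sqrt field_simps)
  hence eq: "(1 / \<delta> + 3 + 3 * (1 / s)) = inverse \<delta> * (1 + 3 * \<delta> + 3 * sqrt (\<delta> / real d))"
    using assms by (simp flip: \<open>\<delta> / s = _\<close> add: field_simps)
  have "level d \<delta> (Suc i) \<le> L + c / s"
    by (simp add: L_def c_def s_def level_width_def)
  hence "level d \<delta> (Suc i) / c \<le> z"
    using c by (simp add: z_def field_simps)
  hence le: "real d * level d \<delta> (Suc i) / c \<le> real d * z"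
    by (metis mult_left_mono of_nat_0_le_iff times_divide_eq_right)
  have "real_of_int (r_plus d \<delta> i) \<le> real d * level d \<delta> (Suc i) / c"
    unfolding r_plus_def c_def by linarith
  hence r_plus: "real_of_int (r_plus d \<delta> i) \<le> real d * z" using le by linarith
  define r where "r = nat (r_plus d \<delta> i)"
  have "real r \<le> real d * z"
    using r_plus z by (cases "r_plus d \<delta> i \<ge> 0") (auto simp: r_def)
  have "shell_indices d \<delta> i \<subseteq> {n. length n = d \<and> sum_list n \<le> r}"
    by (auto simp: shell_indices_def r_def)
  moreover have "finite {n :: nat list. length n = d \<and> sum_list n \<le> r}"
  proof (rule finite_subset)
    show "{n :: nat list. length n = d \<and> sum_list n \<le> r} \<subseteq> {n. set n \<subseteq> {..r} \<and> length n = d}"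
      using member_le_sum_list by fastforce
  qed (rule finite_lists_length_eq, simp)
  ultimately have "card (shell_indices d \<delta> i) \<le> (r + d) choose d"
    using card_mono card_sum_list_le le_trans by meson
  hence "real (card (shell_indices d \<delta> i)) \<le> real ((r + d) choose d)"
    by simp
  also have "\<dots> \<le> entropy_exp z ^ d"
    using z \<open>real r \<le> _\<close> by (rule binomial_le_entropy_exp)
  also have "\<dots> \<le> (1 / \<delta> + 3 + 3 * (1 / s)) ^ d"
    using entropy_exp_shell_le [OF L assms(2,3), of "1 / s"] s
    by (intro power_mono) (auto simp: z_def c_def L_def level_width_def entropy_exp_def)
  also have "\<dots> = \<delta> powi (- int d) * (1 + 3 * \<delta> + 3 * sqrt (\<delta> / real d)) ^ d"
    unfolding eq by (simp add: power_mult_distrib power_int_minus power_inverse)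
  finally show ?thesis .
qed

section \<open>The number of shells\<close>

text \<open>
  The function \<open>u \<mapsto> ln (1 + y exp u)\<close> is convex, so it lies above its tangent at \<open>u = 0\<close>.
\<close>

lemma ln_one_plus_exp_tangent:
  fixes y u :: real
  assumes "y > 0"
  shows "ln (1 + y) + u * (y / (1 + y)) \<le> ln (1 + y * exp u)"
proof -
  define h where "h = y / (1 + y)"
  have h: "0 < h" "h < 1" "(1 + y) * h = y" "(1 + y) * (1 - h) = 1"
    using assms by (auto simp: h_def field_simps)
  have "1 = (1 - h) * (1 + - u * h) + h * (1 + u * (1 - h))"
    by (simp add: algebra_simps)
  also have "\<dots> \<le> (1 - h) * exp (- u * h) + h * exp (u * (1 - h))"
    using h by (intro add_mono mult_left_mono exp_ge_add_one_self) auto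
  also have "\<dots> = exp (- u * h) * ((1 - h) + h * exp u)"
    by (simp add: algebra_simps flip: exp_add)
  finally have "exp (u * h) \<le> (1 - h) + h * exp u"
    by (simp add: exp_minus field_simps)
  hence "(1 + y) * exp (u * h) \<le> (1 + y) * ((1 - h) + h * exp u)"
    using assms by (intro mult_left_mono) auto
  also have "\<dots> = (1 + y) * (1 - h) + ((1 + y) * h) * exp u"
    by (simp add: algebra_simps)
  also have "\<dots> = 1 + y * exp u"
    unfolding h(3,4) by simp
  finally have "ln ((1 + y) * exp (u * h)) \<le> ln (1 + y * exp u)"
    using assms by (intro ln_mono) (auto simp: add_pos_pos)
  thus ?thesis using assms by (simp add: ln_mult h_def)
qed

text \<open>
  The right-hand side increases with \<open>c'\<close>, so it is enough to treat the smallest possible value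
  \<open>v = c (1 + h / s)\<close>, where \<open>h = 1 - exp (- c)\<close>. There both parts of the increase are multiples of
  \<open>h / (s + h)\<close>: it bounds \<open>ln (1 + h / s)\<close> from below, and
  \<open>1 / c - 1 / v = (h / (s + h)) / c\<close>. The claim thus becomes \<open>1 + s / h \<le> 1 + s + s / c\<close>, that is
  \<open>1 / h \<le> 1 + 1 / c\<close>, which is \<open>1 + c \<le> exp c\<close> in disguise.
\<close>

lemma potential_step:
  fixes c c' s :: real
  assumes "c > 0" "s > 0" and c': "c + (1 - exp (- c)) * c / s \<le> c'"
  shows "(1 + s) * ln c - s / c + 1 \<le> (1 + s) * ln c' - s / c'"
proof -
  define h where "h = 1 - exp (- c)"
  define v where "v = c * (1 + h / s)"
  have h: "h > 0" using assms by (simp add: h_def)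
  have "v > 0" using assms h unfolding v_def by (intro mult_pos_pos add_pos_pos) auto
  moreover have "v \<le> c'" using c' by (simp add: v_def h_def algebra_simps)
  ultimately have v: "0 < v" "v \<le> c'" by auto
  have "exp (- c) * (1 + c) \<le> 1"
    using exp_ge_add_one_self [of c] by (simp add: exp_minus field_simps)
  hence "c \<le> h * (1 + c)" by (simp add: h_def algebra_simps)
  hence "s * c \<le> s * (h * (1 + c))"
    using assms by (intro mult_left_mono) auto
  hence key: "s + h \<le> h * (1 + s + s / c)"
    using assms h by (simp add: field_simps)
  have "1 + h / s > 0" using assms h by (simp add: add_pos_pos)
  hence "1 - 1 / (1 + h / s) \<le> ln (1 + h / s)"
    using ln_le_minus_one [of "1 / (1 + h / s)"] by (simp add: ln_div)
  hence lnu: "h / (s + h) \<le> ln (1 + h / s)"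
    using assms h by (simp add: field_simps)
  have "1 \<le> h / (s + h) * (1 + s + s / c)"
    using key assms h by (simp add: le_divide_eq_1_pos)
  also have "\<dots> = (1 + s) * (h / (s + h)) + s / c * (h / (s + h))"
    by (simp only: distrib_right mult.commute [of "h / (s + h)"])
  also have "s / c * (h / (s + h)) = s / c - s / v"
    using assms h unfolding v_def by (simp add: divide_simps add_pos_pos) (simp add: algebra_simps)
  also have "(1 + s) * (h / (s + h)) \<le> (1 + s) * ln (1 + h / s)"
    using lnu assms by (intro mult_left_mono) auto
  also have "ln (1 + h / s) = ln v - ln c"
    using assms \<open>1 + h / s > 0\<close> by (simp add: v_def ln_mult)
  finally have "1 \<le> (1 + s) * (ln v - ln c) + (s / c - s / v)" by simp
  moreover have "(1 + s) * ln v \<le> (1 + s) * ln c'"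
    using v assms by (intro mult_left_mono ln_mono) auto
  moreover have "s / c' \<le> s / v"
    using v assms by (intro divide_left_mono) auto
  ultimately show ?thesis by (simp add: algebra_simps)
qed

lemma level_le_top:
  assumes "0 < \<delta>" "\<delta> < 1"
  shows "level d \<delta> i \<le> real d * ln (inverse \<delta>)"
  using assms by (cases i) (auto simp: ln_inverse mult_nonneg_nonpos)

text \<open>
  At the top level \<open>exp L = \<delta>\<^bsup>- d\<^esup>\<close>, so the width is at most \<open>ln (1 + \<delta>) + d ln (1 / \<delta>)\<close>; then
  \<open>ln x \<le> x - 1\<close> is applied to both logarithms.
\<close>

lemma level_width_le:
  assumes "d \<ge> 1" "0 < \<delta>" "\<delta> < 1"
  shows "level_width d \<delta> i \<le> real d / \<delta>"
proof -
  let ?E = "exp (real d * ln (inverse \<delta>))"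
  have "exp (level d \<delta> i) \<le> ?E" using level_le_top [OF assms(2,3)] by simp
  hence "\<delta> * exp (level d \<delta> i) \<le> \<delta> * ?E" using assms by (intro mult_left_mono) auto
  moreover have "1 \<le> ?E" using level_le_top [OF assms(2,3), of d 0] unfolding one_le_exp_iff by simp
  ultimately have "1 + \<delta> * exp (level d \<delta> i) \<le> (1 + \<delta>) * ?E"
    unfolding distrib_right by linarith
  hence "level_width d \<delta> i \<le> ln ((1 + \<delta>) * ?E)"
    unfolding level_width_def using assms by (intro ln_mono) (auto simp: add_pos_pos)
  also have "\<dots> = ln (1 + \<delta>) + real d * ln (inverse \<delta>)"
    using assms by (simp add: ln_mult)
  also have "\<dots> \<le> \<delta> + real d * (inverse \<delta> - 1)"
    using assms by (intro add_mono mult_left_mono ln_le_minus_one ln_add_one_self_le_self) auto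
  also have "\<dots> \<le> real d / \<delta>"
    using assms by (simp add: algebra_simps divide_inverse)
  finally show ?thesis .
qed

text \<open>
  A step that does not reach the top level has full length. So the potential of
  \<open>potential_step\<close> counts all steps but the last, possibly truncated one, which contributes
  the summand \<open>1\<close>.
\<close>

lemma num_levels_le:
  assumes "d \<ge> 1" "0 < \<delta>" "\<delta> < 1"
  shows "real (num_levels d \<delta>) \<le> 1 + sqrt (real d * \<delta>) / ln (1 + \<delta>)
       + (1 + sqrt (real d * \<delta>)) * ln (real d / (\<delta> * ln (1 + \<delta>)))"
proof -
  define s where "s = sqrt (real d * \<delta>)"
  define c where "c = level_width d \<delta>"
  define J where "J = num_levels d \<delta>"
  define \<Phi> where "\<Phi> = (\<lambda>c. (1 + s) * ln c - s / c)"
  have s: "s > 0" using assms by (simp add: s_def)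
  have c: "c i > 0" for i unfolding c_def by (rule level_width_pos [OF assms(2)])
  have c0: "c 0 = ln (1 + \<delta>)" by (simp add: c_def level_width_def)
  have not_top: "level d \<delta> i \<noteq> real d * ln (inverse \<delta>)" if "i < J" for i
    using that not_less_Least unfolding J_def num_levels_def by blast
  have top: "level d \<delta> J = real d * ln (inverse \<delta>)"
    unfolding J_def num_levels_def using level_reaches_top [OF assms] by (rule LeastI_ex)
  have step: "\<Phi> (c i) + 1 \<le> \<Phi> (c (Suc i))" if "Suc i < J" for i
  proof -
    let ?y = "\<delta> * exp (level d \<delta> i)"
    have y: "?y > 0" using assms by simp
    have "level d \<delta> (Suc i) = level d \<delta> i + c i / s"
      using not_top [OF that] by (auto simp: c_def level_width_def s_def min_def split: if_splits)
    hence "c (Suc i) = ln (1 + ?y * exp (c i / s))"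
      by (simp add: c_def level_width_def exp_add mult_ac)
    moreover have "?y / (1 + ?y) = 1 - exp (- c i)"
      using y by (simp add: c_def level_width_def exp_minus add_pos_pos field_simps)
    ultimately have "c i + (1 - exp (- c i)) * c i / s \<le> c (Suc i)"
      using ln_one_plus_exp_tangent [OF y, of "c i / s"]
      by (simp add: c_def level_width_def mult_ac)
    thus ?thesis unfolding \<Phi>_def by (intro potential_step c s)
  qed
  have count: "\<Phi> (c 0) + real i \<le> \<Phi> (c i)" if "i < J" for i
    using that
  proof (induction i)
    case (Suc i)
    thus ?case using step [of i] by simp
  qed simp
  have "J \<noteq> 0"
  proof
    assume "J = 0"
    hence "real d * ln (inverse \<delta>) = 0" using top by simp
    thus False using assms by (simp add: ln_inverse)
  qed
  define m where "m = c (J - 1)"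
  have m: "m > 0" "m \<le> real d / \<delta>"
    using c level_width_le [OF assms] by (auto simp: m_def c_def)
  have "real J - 1 \<le> \<Phi> m - \<Phi> (c 0)"
    using count [of "J - 1"] \<open>J \<noteq> 0\<close> by (simp add: m_def of_nat_diff)
  also have "\<dots> \<le> s / c 0 + (1 + s) * (ln m - ln (c 0))"
    using s m by (simp add: \<Phi>_def algebra_simps)
  also have "\<dots> \<le> s / c 0 + (1 + s) * (ln (real d / \<delta>) - ln (c 0))"
    using s m by (intro add_left_mono mult_left_mono diff_right_mono ln_mono) auto
  also have "ln (real d / \<delta>) - ln (c 0) = ln (real d / (\<delta> * ln (1 + \<delta>)))"
    using assms c [of 0] by (simp add: c0 ln_div ln_mult)
  finally have "real J - 1 \<le> s / c 0 + (1 + s) * ln (real d / (\<delta> * ln (1 + \<delta>)))"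
    using s by simp
  thus ?thesis by (simp add: J_def s_def c0)
qed

theorem corollary5p5:
  fixes d :: nat and \<delta> :: real
  assumes "d \<ge> 1" and "0 < \<delta>" and "\<delta> < 1"
  shows "real (B_shell d \<delta>) \<le>
    real d +
    (1 + sqrt (real d * \<delta>) / ln (1 + \<delta>)
       + (1 + sqrt (real d * \<delta>)) * ln (real d / (\<delta> * ln (1 + \<delta>))))
    * \<delta> powi (- int d) * (1 + 3 * \<delta> + 3 * sqrt (\<delta> / real d)) ^ d"
proof -
  let ?M = "\<delta> powi (- int d) * (1 + 3 * \<delta> + 3 * sqrt (\<delta> / real d)) ^ d"
  have "(\<Sum>i<num_levels d \<delta>. real (card (shell_indices d \<delta> i))) \<le> real (num_levels d \<delta>) * ?M"
    using sum_bounded_above [of "{..<num_levels d \<delta>}" _ ?M] card_shell_indices_le [OF assms]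
    by simp
  also have "\<dots> \<le> (1 + sqrt (real d * \<delta>) / ln (1 + \<delta>)
       + (1 + sqrt (real d * \<delta>)) * ln (real d / (\<delta> * ln (1 + \<delta>)))) * ?M"
    using assms by (intro mult_right_mono num_levels_le) auto
  finally show ?thesis
    by (simp add: B_shell_def mult.assoc)
qed

end
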